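(* Let $q\ge 2$ be a prime power and let $\ell$ be an integer with $2\le \ell\le q$. Then the $\ell\times\ell$ lower-right submatrix of the $q$-ary Reed–Solomon matrix $G_{\rm RS}(q)$ attains the maximum of the exponent $E_{\mathrm c}(G)$ over all invertible $\ell\times\ell$ matrices $G$ over $\mathbb{F}_q$, and this maximum is $$E_{\max}(q,\ell)=\frac{\log(\ell!)}{\ell\log\ell}.$$
   Context: For an invertible $\ell\times\ell$ matrix $G$ over $\mathbb{F}_q$ (rows indexed from $0$), $E_{\mathrm c}(G):=\frac{1}{\ell\log\ell}\sum_{i=0}^{\ell-1}\log D_{\mathrm c}^{(i)}(G)$, where $D_{\mathrm c}^{(i)}(G)$ is the Hamming distance between the $i$-th row of $G$ and the linear span of rows $i+1,\dots,\ell-1$ of $G$ (the zero space if $i=\ell-1$). $E_{\max}(q,\ell)$ denotes the maximum of $E_{\mathrm c}(G)$ over $\ell\times\ell$ matrices over $\mathbb{F}_q$. With $\alpha$ a primitive element of $\mathbb{F}_q$, the Reed–Solomon matrix $G_{\rm RS}(q)$ is the $q\times q$ matrix over $\mathbb{F}_q$ with rows and columns indexed by $0,\dots,q-1$, whose $(i,j)$ entry is $\alpha^{ij}$ for $0\le i\le q-1$, $0\le j\le q-2$, and whose last column ($j=q-1$) is $0$ in rows $0,\dots,q-2$ and $1$ in row $q-1$. (So row $i$ is the evaluation of the monomial $x^{q-1-i}$ at the points $x_j=\alpha^{-j}$, $0\le j\le q-2$, and $x_{q-1}=0$, with $0^0=1$.) The $\ell\times\ell$ lower-right submatrix consists of the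 last $\ell$ rows and last $\ell$ columns. *)

theory Defs
  imports Complex_Main "HOL-Library.Cardinality" "Jordan_Normal_Form.VS_Connect"
begin

definition hamming_dist :: "'a vec \<Rightarrow> 'a vec \<Rightarrow> nat" where
  "hamming_dist v w = card {k. k < dim_vec v \<and> v $ k \<noteq> w $ k}"

definition hamming_dist_set :: "'a vec \<Rightarrow> 'a vec set \<Rightarrow> nat" where
  "hamming_dist_set v W = (INF w\<in>W. hamming_dist v w)"

(* For the last row the spanning set is empty and its span is the zero space. *)
definition partial_dist :: "'a::field mat \<Rightarrow> nat \<Rightarrow> nat" where
  "partial_dist G i =
     hamming_dist_set (row G i)
       (LinearCombinations.module.span class_ring (module_vec TYPE('a) (dim_col G))
          {row G j |j. i < j \<and> j < dim_row G})"

(* A quotient of logarithms, hence independent of the base; we use ln. *)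
definition exponent_c :: "'a::field mat \<Rightarrow> real" where
  "exponent_c G =
     1 / (real (dim_row G) * ln (real (dim_row G))) *
       (\<Sum>i<dim_row G. ln (real (partial_dist G i)))"

definition invertible_mats :: "nat \<Rightarrow> 'a::field mat set" where
  "invertible_mats l = {G \<in> carrier_mat l l. invertible_mat G}"

(* The field with q elements is the type 'a, so q = CARD('a). Only invertible matrices
   are considered: for a singular matrix some partial distance is 0, where the convention
   ln 0 = 0 differs from log 0 = -infinity. *)
definition exponent_max :: "'a::{field,finite} itself \<Rightarrow> nat \<Rightarrow> real" where
  "exponent_max _ l = Max (exponent_c ` (invertible_mats l :: 'a mat set))"

definition primitive_element :: "'a::field \<Rightarrow> bool" where
  "primitive_element \<alpha> \<longleftrightarrow> \<alpha> \<noteq> 0 \<and> (\<forall>x. x \<noteq> 0 \<longrightarrow> (\<exists>k::nat. x = \<alpha> ^ k))"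

definition RS_mat :: "'a::{field,finite} \<Rightarrow> 'a mat" where
  "RS_mat \<alpha> = mat CARD('a) CARD('a)
     (\<lambda>(i, j). if j < CARD('a) - 1 then \<alpha> ^ (i * j)
               else if i < CARD('a) - 1 then 0 else 1)"

definition lower_right_submat :: "nat \<Rightarrow> 'a mat \<Rightarrow> 'a mat" where
  "lower_right_submat l A =
     mat l l (\<lambda>(i, j). A $$ (dim_row A - l + i, dim_col A - l + j))"

end

theory Submission
  imports Defs
begin

(* Upper bound: adding the rows of G from the bottom up, each new row is independent of the ones
   below, so one more coordinate can be prescribed freely in the span.  Hence the span of the rows
   below row i contains a vector agreeing with row i in l - 1 - i coordinates, that is, the i-th
   partial distance is at most i + 1 (the Singleton bound).
   Equality: up to the order of rows, the lower-right submatrix is a Vandermonde matrix at l distinct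
   points.  A difference of row i and a combination of the rows below it is the evaluation of a monic
   polynomial of degree l - 1 - i, which has at most l - 1 - i zeros. *)

abbreviation vec_span :: "nat \<Rightarrow> 'a::field vec set \<Rightarrow> 'a vec set" where
  "vec_span n \<equiv> LinearCombinations.module.span class_ring (module_vec TYPE('a) n)"

text \<open>Exponents decrease downwards, so that the rows below row \<open>i\<close> evaluate
  exactly the monomials of degree less than \<open>n - 1 - i\<close>.\<close>

definition vandermonde_rev :: "nat \<Rightarrow> (nat \<Rightarrow> 'a::field) \<Rightarrow> 'a mat" where
  "vandermonde_rev n x = mat n n (\<lambda>(i, j). x j ^ (n - 1 - i))"

section \<open>Closure properties of spans of vectors\<close>

text \<open>The vectors of dimension \<open>n\<close> with property \<open>P\<close> form a
  submodule; containing \<open>S\<close>, it contains the span of \<open>S\<close>.\<close>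

lemma vec_span_induct:
  assumes S: "S \<subseteq> carrier_vec n"
    and v: "(v::'a::field vec) \<in> vec_span n S"
    and gen: "\<And>v. v \<in> S \<Longrightarrow> P v"
    and zero: "P (0\<^sub>v n)"
    and add: "\<And>v w. v \<in> carrier_vec n \<Longrightarrow> w \<in> carrier_vec n \<Longrightarrow> P v \<Longrightarrow> P w \<Longrightarrow> P (v + w)"
    and smult: "\<And>c v. v \<in> carrier_vec n \<Longrightarrow> P v \<Longrightarrow> P (c \<cdot>\<^sub>v v)"
  shows "P v"
proof -
  interpret vec_space "TYPE('a)" n .
  have "submodule class_ring {v \<in> carrier_vec n. P v} V"
    by (rule submodule.intro) (use vec_module zero add smult in \<open>auto simp: module_vec_simps\<close>)
  then have "span S \<subseteq> {v \<in> carrier_vec n. P v}"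
    by (rule span_is_subset[rotated]) (use S gen in auto)
  with v show ?thesis by auto
qed

lemma vec_span_smult:
  assumes "S \<subseteq> carrier_vec n" "(v::'a::field vec) \<in> vec_span n S"
  shows "c \<cdot>\<^sub>v v \<in> vec_span n S"
proof -
  interpret vec_space "TYPE('a)" n .
  show ?thesis
    using submodule.smult_closed[OF span_is_submodule[OF assms(1)], of c v] assms(2)
    by (simp add: module_vec_simps class_ring_simps)
qed

lemma vec_span_add:
  assumes "S \<subseteq> carrier_vec n" "(v::'a::field vec) \<in> vec_span n S" "w \<in> vec_span n S"
  shows "v + w \<in> vec_span n S"
proof -
  interpret vec_space "TYPE('a)" n .
  show ?thesis using span_add1[OF assms] .
qed

section \<open>Information sets and the Singleton bound\<close>

text \<open>Column \<open>i\<close> of an inverse of \<open>G\<close> is orthogonal to every other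
  row of \<open>G\<close>, hence to the span of the rows below, but has product 1 with row
  \<open>i\<close>.\<close>

lemma row_notin_span_rows_below:
  assumes G: "G \<in> invertible_mats n" and i: "i < n"
  shows "row G i \<notin> vec_span n {row G j |j. i < j \<and> j < n}"
proof
  assume mem: "row G i \<in> vec_span n {row G j |j. i < j \<and> j < n}"
  from G have Gc: "G \<in> carrier_mat n n"
    by (auto simp: invertible_mats_def)
  from G obtain B where GB: "G * B = 1\<^sub>m n" and BG: "B * G = 1\<^sub>m (dim_row B)"
    by (auto simp: invertible_mats_def invertible_mat_def inverts_mat_def)
  have "dim_col B = n" using GB by (metis index_mult_mat(3) index_one_mat(3))
  moreover have "dim_row B = n" using BG Gc by (metis index_mult_mat(3) index_one_mat(3) carrier_matD(2))
  ultimately have Bc: "B \<in> carrier_mat n n" by auto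
  have entry: "row G j \<bullet> col B i = (if j = i then 1 else 0)" if "j < n" for j
    using arg_cong[OF GB, of "\<lambda>M. M $$ (j, i)"] that i Gc Bc by auto
  have cB: "col B i \<in> carrier_vec n" using Bc by auto
  have "row G i \<bullet> col B i = 0"
  proof (rule vec_span_induct[OF _ mem])
    show "{row G j |j. i < j \<and> j < n} \<subseteq> carrier_vec n" using Gc by auto
    show "v \<bullet> col B i = 0" if "v \<in> {row G j |j. i < j \<and> j < n}" for v
      using that entry by auto
    show "0\<^sub>v n \<bullet> col B i = 0" using cB by simp
    show "(v + w) \<bullet> col B i = 0" if "v \<in> carrier_vec n" "w \<in> carrier_vec n"
      "v \<bullet> col B i = 0" "w \<bullet> col B i = 0" for v w
      using that cB by (simp add: add_scalar_prod_distrib[of _ n])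
    show "(c \<cdot>\<^sub>v v) \<bullet> col B i = 0" if "v \<in> carrier_vec n" "v \<bullet> col B i = 0" for c v
      using that cB by simp
  qed
  with entry[OF i] show False by simp
qed

text \<open>Downward induction on \<open>i\<close>: a new row gives a vector that vanishes on the
  old coordinate set but not at some new coordinate \<open>c\<close>. Multiples of it correct the
  value at \<open>c\<close> and leave the old coordinates alone.\<close>

lemma ex_information_set:
  fixes G :: "'a::field mat"
  assumes G: "G \<in> invertible_mats n" and i: "i \<le> n"
  shows "\<exists>S\<subseteq>{..<n}. card S = n - i \<and>
    (\<forall>u. \<exists>w\<in>vec_span n {row G j |j. i \<le> j \<and> j < n}. \<forall>k\<in>S. w $ k = u k)"
  using i
proof (induction rule: inc_induct)
  case base
  interpret vec_space "TYPE('a)" n .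
  have "{row G j |j. n \<le> j \<and> j < n} = {}" by auto
  then show ?case by (intro exI[of _ "{}"]) (auto simp: span_empty)
next
  case (step i)
  interpret vec_space "TYPE('a)" n .
  from G have Gc: "G \<in> carrier_mat n n" by (auto simp: invertible_mats_def)
  let ?A = "{row G j |j. i < j \<and> j < n}" and ?B = "{row G j |j. i \<le> j \<and> j < n}"
  let ?r = "row G i"
  have A: "?A \<subseteq> carrier_vec n" and B: "?B \<subseteq> carrier_vec n" using Gc by auto
  have AB: "vec_span n ?A \<subseteq> vec_span n ?B" by (rule span_is_monotone) auto
  have r: "?r \<in> vec_span n ?B" using step.hyps in_own_span[OF B] by auto
  from step.IH obtain S where S: "S \<subseteq> {..<n}" "card S = n - Suc i"
    and ext: "\<And>u. \<exists>w\<in>vec_span n ?A. \<forall>k\<in>S. w $ k = u k"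
    by (auto simp: Suc_le_eq)
  \<comment> \<open>Prescribing the entries of row \<open>i\<close> on \<open>S\<close> makes the
    difference \<open>d\<close> below vanish on \<open>S\<close>.\<close>
  obtain w where w: "w \<in> vec_span n ?A" "\<forall>k\<in>S. w $ k = ?r $ k" using ext by blast
  have wc: "w \<in> carrier_vec n" using w A span_closed by blast
  have rc: "?r \<in> carrier_vec n" using Gc step.hyps by auto
  have "?r \<noteq> w" using row_notin_span_rows_below[OF G] step.hyps w by auto
  then obtain c where c: "c < n" "?r $ c \<noteq> w $ c"
    using wc rc by (metis carrier_vecD eq_vecI)
  have cS: "c \<notin> S" using c w by metis
  define d where "d = ?r + (- 1) \<cdot>\<^sub>v w"
  have d: "d \<in> vec_span n ?B"
    unfolding d_def using w AB by (intro vec_span_add[OF B r] vec_span_smult[OF B]) auto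
  have dc: "d \<in> carrier_vec n" using wc rc by (auto simp: d_def)
  have dk: "d $ k = ?r $ k - w $ k" if "k < n" for k
    using that wc rc by (auto simp: d_def)
  show ?case
  proof (intro exI[of _ "insert c S"] conjI allI)
    show "insert c S \<subseteq> {..<n}" using S c by auto
    show "card (insert c S) = n - i"
      using S cS step.hyps finite_subset[OF S(1)] by auto
    fix u :: "nat \<Rightarrow> 'a"
    obtain v where v: "v \<in> vec_span n ?A" "\<forall>k\<in>S. v $ k = u k" using ext by blast
    have vc: "v \<in> carrier_vec n" using v A span_closed by blast
    \<comment> \<open>The factor is the error of \<open>v\<close> at \<open>c\<close>, scaled by the
      nonzero entry \<open>d $ c\<close>.\<close>
    let ?v = "v + ((u c - v $ c) / d $ c) \<cdot>\<^sub>v d"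
    have idx: "?v $ k = v $ k + (u c - v $ c) / (?r $ c - w $ c) * (?r $ k - w $ k)"
      if "k < n" for k
      using that vc dc c by (simp add: dk)
    show "\<exists>w\<in>vec_span n ?B. \<forall>k\<in>insert c S. w $ k = u k"
    proof (intro bexI ballI)
      show "?v \<in> vec_span n ?B"
        using v AB by (intro vec_span_add[OF B] vec_span_smult[OF B] d) auto
      show "?v $ k = u k" if "k \<in> insert c S" for k
        using that c S v w by (subst idx) auto
    qed
  qed
qed

text \<open>Some vector in the span of the lower rows agrees with row \<open>i\<close> on an
  information set of size \<open>n - Suc i\<close>, which leaves \<open>Suc i\<close> coordinates
  for disagreement.\<close>

lemma partial_dist_le:
  fixes G :: "'a::field mat"
  assumes G: "G \<in> invertible_mats n" and i: "i < n"
  shows "partial_dist G i \<le> Suc i"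
proof -
  from G have Gc: "G \<in> carrier_mat n n" by (auto simp: invertible_mats_def)
  let ?W = "vec_span n {row G j |j. i < j \<and> j < n}"
  obtain S where S: "S \<subseteq> {..<n}" "card S = n - Suc i"
    and ext: "\<And>u. \<exists>w\<in>?W. \<forall>k\<in>S. w $ k = u k"
    using ex_information_set[OF G, of "Suc i"] i by (auto simp: Suc_le_eq)
  obtain w where w: "w \<in> ?W" "\<forall>k\<in>S. w $ k = row G i $ k" using ext by blast
  have "partial_dist G i \<le> hamming_dist (row G i) w"
    unfolding partial_dist_def hamming_dist_set_def using Gc w(1) by (auto intro: cINF_lower)
  also have "\<dots> \<le> card ({..<n} - S)"
    unfolding hamming_dist_def using Gc w(2) by (intro card_mono) auto
  also have "\<dots> = Suc i"
    using S i finite_subset[OF S(1)] by (subst card_Diff_subset) auto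
  finally show ?thesis .
qed

section \<open>Vandermonde matrices\<close>

lemma poly_zeros_on_points_le:
  fixes p :: "'a::field poly"
  assumes "p \<noteq> 0" "inj_on x A"
  shows "card {j \<in> A. poly p (x j) = 0} \<le> degree p"
proof -
  have "card {j \<in> A. poly p (x j) = 0} = card (x ` {j \<in> A. poly p (x j) = 0})"
    using assms(2) by (intro card_image[symmetric]) (auto intro: inj_on_subset)
  also have "\<dots> \<le> card {z. poly p z = 0}"
    using assms(1) by (intro card_mono poly_roots_finite) auto
  also have "\<dots> \<le> degree p" using assms(1) by (rule card_poly_roots_bound)
  finally show ?thesis .
qed

text \<open>A kernel vector of the transpose is the coefficient vector of a polynomial of degree
  less than \<open>n\<close> that vanishes at \<open>n\<close> distinct points.\<close>

lemma vandermonde_rev_invertible: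
  fixes x :: "nat \<Rightarrow> 'a::field"
  assumes x: "inj_on x {..<n}"
  shows "vandermonde_rev n x \<in> invertible_mats n"
proof -
  let ?V = "vandermonde_rev n x"
  have V: "?V \<in> carrier_mat n n" by (simp add: vandermonde_rev_def)
  have "det ?V \<noteq> 0"
  proof
    assume "det ?V = 0"
    then have "det (?V\<^sup>T) = 0" using V by (simp add: det_transpose)
    then obtain v where v: "v \<in> carrier_vec n" "v \<noteq> 0\<^sub>v n" and 0: "?V\<^sup>T *\<^sub>v v = 0\<^sub>v n"
      using det_0_iff_vec_prod_zero_field[of "?V\<^sup>T" n] V by auto
    define p where "p = (\<Sum>i<n. monom (v $ i) (n - 1 - i))"
    \<comment> \<open>The exponents \<open>n - 1 - i\<close> are distinct, so no two terms of
      \<open>p\<close> merge and \<open>v\<close> can be read off.\<close>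
    have coeff: "coeff p (n - 1 - i) = v $ i" if "i < n" for i
    proof -
      have "coeff p (n - 1 - i) = (\<Sum>j<n. if j = i then v $ j else 0)"
        unfolding p_def coeff_sum coeff_monom
        by (rule sum.cong) (use that in auto)
      then show ?thesis using that by simp
    qed
    obtain i where i: "i < n" "v $ i \<noteq> 0" using v by (metis carrier_vecD eq_vecI index_zero_vec)
    then have "p \<noteq> 0" using coeff[OF i(1)] by auto
    have root: "poly p (x j) = 0" if "j < n" for j
    proof -
      have "poly p (x j) = (?V\<^sup>T *\<^sub>v v) $ j"
        using that v by (simp add: p_def poly_sum poly_monom vandermonde_rev_def scalar_prod_def
            lessThan_atLeast0 mult.commute)
      with 0 that show ?thesis by simp
    qed
    have "degree p \<le> n - 1"
      unfolding p_def
      by (intro degree_sum_le) (auto intro: order.trans[OF degree_monom_le])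
    moreover have "card {j \<in> {..<n}. poly p (x j) = 0} \<le> degree p"
      using \<open>p \<noteq> 0\<close> x by (rule poly_zeros_on_points_le)
    moreover have "{j \<in> {..<n}. poly p (x j) = 0} = {..<n}" using root by auto
    ultimately show False using i(1) by simp
  qed
  from det_non_zero_imp_unit[OF V this, of "()"]
  obtain B where "B \<in> carrier_mat n n" "B * ?V = 1\<^sub>m n" "?V * B = 1\<^sub>m n"
    by (auto simp: Units_def ring_mat_def)
  then show ?thesis
    using V by (auto simp: invertible_mats_def invertible_mat_def inverts_mat_def)
qed

lemma partial_dist_vandermonde_rev:
  fixes x :: "nat \<Rightarrow> 'a::field"
  assumes x: "inj_on x {..<n}" and i: "i < n"
  shows "partial_dist (vandermonde_rev n x) i = Suc i"
proof (rule antisym)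
  let ?V = "vandermonde_rev n x"
  show "partial_dist ?V i \<le> Suc i"
    using vandermonde_rev_invertible[OF x] i by (rule partial_dist_le)
  interpret vec_space "TYPE('a)" n .
  let ?S = "{row ?V j |j. i < j \<and> j < n}"
  have S: "?S \<subseteq> carrier_vec n" by (auto simp: vandermonde_rev_def)
  let ?d = "n - 1 - i"
  have "Suc i \<le> hamming_dist (row ?V i) w" if w: "w \<in> vec_span n ?S" for w
  proof -
    \<comment> \<open>Vanishing coefficients encode degree less than \<open>?d\<close>; the
      inequality \<open>degree p < ?d\<close> would exclude the zero polynomial when
      \<open>?d = 0\<close>, that is, for the last row.\<close>
    have "\<exists>p. (\<forall>k\<ge>?d. coeff p k = 0) \<and> (\<forall>j<n. w $ j = poly p (x j))"
    proof (rule vec_span_induct[OF S w])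
      fix v assume "v \<in> ?S"
      then obtain m where "i < m" "m < n" "v = row ?V m" by auto
      then show "\<exists>p. (\<forall>k\<ge>?d. coeff p k = 0) \<and> (\<forall>j<n. v $ j = poly p (x j))"
        by (intro exI[of _ "monom 1 (n - 1 - m)"]) (auto simp: vandermonde_rev_def poly_monom)
    next
      show "\<exists>p. (\<forall>k\<ge>?d. coeff p k = 0) \<and> (\<forall>j<n. 0\<^sub>v n $ j = poly p (x j))"
        by (intro exI[of _ 0]) auto
    next
      fix v w :: "'a vec"
      assume "v \<in> carrier_vec n" "w \<in> carrier_vec n"
        and "\<exists>p. (\<forall>k\<ge>?d. coeff p k = 0) \<and> (\<forall>j<n. v $ j = poly p (x j))"
        and "\<exists>p. (\<forall>k\<ge>?d. coeff p k = 0) \<and> (\<forall>j<n. w $ j = poly p (x j))"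
      then obtain p q where "\<forall>k\<ge>?d. coeff p k = 0" "\<forall>j<n. v $ j = poly p (x j)"
        "\<forall>k\<ge>?d. coeff q k = 0" "\<forall>j<n. w $ j = poly q (x j)" by blast
      with \<open>w \<in> carrier_vec n\<close>
      show "\<exists>p. (\<forall>k\<ge>?d. coeff p k = 0) \<and> (\<forall>j<n. (v + w) $ j = poly p (x j))"
        by (intro exI[of _ "p + q"]) auto
    next
      fix c :: 'a and v :: "'a vec"
      assume "v \<in> carrier_vec n"
        and "\<exists>p. (\<forall>k\<ge>?d. coeff p k = 0) \<and> (\<forall>j<n. v $ j = poly p (x j))"
      then obtain p where "\<forall>k\<ge>?d. coeff p k = 0" "\<forall>j<n. v $ j = poly p (x j)" by blast
      with \<open>v \<in> carrier_vec n\<close>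
      show "\<exists>p. (\<forall>k\<ge>?d. coeff p k = 0) \<and> (\<forall>j<n. (c \<cdot>\<^sub>v v) $ j = poly p (x j))"
        by (intro exI[of _ "Polynomial.smult c p"]) auto
    qed
    then obtain p where p: "\<forall>k\<ge>?d. coeff p k = 0" "\<forall>j<n. w $ j = poly p (x j)" by blast
    \<comment> \<open>The values of \<open>f\<close> at the points are the entries of row
      \<open>i\<close> minus those of \<open>w\<close>; since \<open>p\<close> has no term of degree
      \<open>?d\<close>, \<open>f\<close> is monic.\<close>
    define f where "f = monom 1 ?d - p"
    have "coeff f ?d = 1" using p(1) by (simp add: f_def)
    then have "f \<noteq> 0" by auto
    have "degree f \<le> ?d" using p(1) by (intro degree_le) (auto simp: f_def)
    then have "card {j \<in> {..<n}. poly f (x j) = 0} \<le> ?d"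
      using poly_zeros_on_points_le[OF \<open>f \<noteq> 0\<close> x] by simp
    moreover have "hamming_dist (row ?V i) w = card ({..<n} - {j \<in> {..<n}. poly f (x j) = 0})"
      unfolding hamming_dist_def
      by (rule arg_cong[of _ _ card]) (use p(2) i in \<open>auto simp: vandermonde_rev_def f_def poly_monom\<close>)
    ultimately show ?thesis using i by (subst (asm) card_Diff_subset) auto
  qed
  \<comment> \<open>An infimum of naturals is a greatest lower bound only over a nonempty
    set.\<close>
  moreover have "vec_span n ?S \<noteq> {}" using span_zero by blast
  ultimately show "Suc i \<le> partial_dist ?V i"
    by (auto simp: partial_dist_def hamming_dist_set_def vandermonde_rev_def intro: cINF_greatest)
qed

section \<open>From partial distances to the exponent\<close>

lemma exponent_c_le:
  fixes G :: "'a::field mat"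
  assumes G: "G \<in> invertible_mats n"
  shows "exponent_c G \<le> ln (fact n) / (real n * ln (real n))"
proof -
  from G have n: "dim_row G = n" by (auto simp: invertible_mats_def)
  have "ln (real (partial_dist G i)) \<le> ln (real (Suc i))" if "i < n" for i
    \<comment> \<open>At distance 0 the convention \<open>ln 0 = 0\<close> still gives the
      inequality, as \<open>ln (real (Suc i))\<close> is nonnegative.\<close>
    using partial_dist_le[OF G that] by (cases "partial_dist G i = 0") auto
  then have "(\<Sum>i<n. ln (real (partial_dist G i))) \<le> (\<Sum>i<n. ln (real (Suc i)))"
    by (intro sum_mono) auto
  also have "\<dots> = ln (fact n)"
    by (simp add: fact_prod_Suc ln_prod lessThan_atLeast0 del: of_nat_Suc)
  finally show ?thesis
    unfolding exponent_c_def n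
    \<comment> \<open>For positive \<open>n\<close> the denominator is nonnegative; where it is 0,
      both quotients are 0.\<close>
    by (cases "n = 0") (auto intro!: divide_right_mono)
qed

lemma exponent_c_vandermonde_rev:
  fixes x :: "nat \<Rightarrow> 'a::field"
  assumes "inj_on x {..<n}"
  shows "exponent_c (vandermonde_rev n x) = ln (fact n) / (real n * ln (real n))"
proof -
  have "(\<Sum>i<n. ln (real (partial_dist (vandermonde_rev n x) i))) = (\<Sum>i<n. ln (real (Suc i)))"
    using assms by (intro sum.cong) (auto simp: partial_dist_vandermonde_rev)
  also have "\<dots> = ln (fact n)"
    by (simp add: fact_prod_Suc ln_prod lessThan_atLeast0 del: of_nat_Suc)
  finally show ?thesis by (simp add: exponent_c_def) (simp add: vandermonde_rev_def)
qed

section \<open>The Reed-Solomon submatrix as a Vandermonde matrix\<close>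

text \<open>Multiplication by \<alpha> permutes the nonzero elements; comparing their products gives
  the second claim. Exponents can then be reduced modulo \<open>CARD('a) - 1\<close>, so that many
  powers already cover all nonzero elements, and counting gives injectivity.\<close>

lemma primitive_element_powers:
  fixes \<alpha> :: "'a::{field,finite}"
  assumes "primitive_element \<alpha>"
  shows "inj_on (\<lambda>k. \<alpha> ^ k) {..<CARD('a) - 1}" and "\<alpha> ^ (CARD('a) - 1) = 1"
proof -
  let ?U = "UNIV - {0::'a}" and ?m = "CARD('a) - 1"
  from assms have \<alpha>: "\<alpha> \<noteq> 0" "\<And>x. x \<noteq> 0 \<Longrightarrow> \<exists>k. x = \<alpha> ^ k"
    by (auto simp: primitive_element_def)
  have card: "card ?U = ?m" by (simp add: card_Diff_subset)
  have bij: "bij_betw ((*) \<alpha>) ?U ?U"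
    by (rule bij_betw_byWitness[where f' = "\<lambda>x. x / \<alpha>"]) (use \<alpha>(1) in auto)
  have "(\<Prod>x\<in>?U. x) = (\<Prod>x\<in>?U. \<alpha> * x)"
    using prod.reindex_bij_betw[OF bij, of "\<lambda>x. x"] by simp
  also have "\<dots> = \<alpha> ^ ?m * (\<Prod>x\<in>?U. x)"
    by (simp only: prod.distrib prod_constant card)
  finally show one: "\<alpha> ^ ?m = 1" by (auto simp: prod_zero_iff)
  have "card {0, 1::'a} \<le> CARD('a)" by (rule card_mono) auto
  then have "?m > 0" by simp
  have "?U \<subseteq> (\<lambda>k. \<alpha> ^ k) ` {..<?m}"
  proof
    fix y assume "y \<in> ?U"
    then obtain k where "y = \<alpha> ^ k" using \<alpha>(2) by auto
    also have "\<dots> = \<alpha> ^ (?m * (k div ?m) + k mod ?m)" by (simp only: mult_div_mod_eq)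
    also have "\<dots> = \<alpha> ^ (k mod ?m)" by (simp only: power_add power_mult one) simp
    finally show "y \<in> (\<lambda>k. \<alpha> ^ k) ` {..<?m}" using \<open>?m > 0\<close> by auto
  qed
  moreover have "(\<lambda>k. \<alpha> ^ k) ` {..<?m} \<subseteq> ?U" using \<alpha>(1) by auto
  ultimately have "(\<lambda>k. \<alpha> ^ k) ` {..<?m} = ?U" by blast
  then show "inj_on (\<lambda>k. \<alpha> ^ k) {..<?m}"
    using card by (intro eq_card_imp_inj_on) auto
qed

lemma lower_right_RS_mat_eq_vandermonde_rev:
  fixes \<alpha> :: "'a::{field,finite}"
  assumes \<alpha>: "primitive_element \<alpha>" and l: "0 < l" "l \<le> CARD('a)"
  obtains x where "inj_on x {..<l}" "lower_right_submat l (RS_mat \<alpha>) = vandermonde_rev l x"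
proof
  let ?q = "CARD('a)"
  \<comment> \<open>These are the last \<open>l\<close> Reed-Solomon points: inverse powers of
    \<alpha>, then 0 for the last column.\<close>
  define x where "x j = (if j < l - 1 then inverse (\<alpha> ^ (?q - l + j)) else 0)" for j
  from \<alpha> have nz: "\<alpha> \<noteq> 0" by (simp add: primitive_element_def)
  show "inj_on x {..<l}"
  proof (rule inj_onI)
    fix j k assume jk: "j \<in> {..<l}" "k \<in> {..<l}" "x j = x k"
    show "j = k"
    proof (cases "j < l - 1 \<and> k < l - 1")
      case True
      then have "\<alpha> ^ (?q - l + j) = \<alpha> ^ (?q - l + k)" using jk by (simp add: x_def)
      then have "?q - l + j = ?q - l + k"
        by (rule inj_onD[OF primitive_element_powers(1)[OF \<alpha>]]) (use True l in auto)
      then show ?thesis by simp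
    next
      case False
      \<comment> \<open>If only one index is \<open>l - 1\<close>, its point is 0 while the other
        point is nonzero.\<close>
      with jk nz show ?thesis by (auto simp: x_def split: if_splits)
    qed
  qed
  show "lower_right_submat l (RS_mat \<alpha>) = vandermonde_rev l x"
  proof (rule eq_matI)
    fix i j assume "i < dim_row (vandermonde_rev l x)" "j < dim_col (vandermonde_rev l x)"
    then have ij: "i < l" "j < l" by (auto simp: vandermonde_rev_def)
    let ?c = "?q - l + j"
    \<comment> \<open>The row index \<open>?q - l + i\<close> and the degree
      \<open>l - 1 - i\<close> add up to \<open>?q - 1\<close>, and \<alpha> to that power is 1; so
      the two powers of \<open>\<alpha> ^ ?c\<close> are mutually inverse.\<close>
    have "\<alpha> ^ ((?q - l + i) * ?c) = inverse (\<alpha> ^ ?c) ^ (l - 1 - i)"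
    proof -
      have "(?q - l + i) * ?c + ?c * (l - 1 - i) = ?c * (?q - 1)"
      proof -
        have "(?q - l + i) * ?c + ?c * (l - 1 - i) = ?c * ((?q - l + i) + (l - 1 - i))"
          by (simp only: add_mult_distrib2 mult.commute)
        also have "(?q - l + i) + (l - 1 - i) = ?q - 1" using ij l by simp
        finally show ?thesis .
      qed
      then have "\<alpha> ^ ((?q - l + i) * ?c) * (\<alpha> ^ ?c) ^ (l - 1 - i) = (\<alpha> ^ (?q - 1)) ^ ?c"
        by (simp only: power_mult[symmetric] power_add[symmetric] mult.commute add.commute)
      also have "\<dots> = 1" by (simp only: primitive_element_powers(2)[OF \<alpha>] power_one)
      finally show ?thesis
        by (metis inverse_unique power_inverse mult.commute)
    qed
    then show "lower_right_submat l (RS_mat \<alpha>) $$ (i, j) = vandermonde_rev l x $$ (i, j)"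
      using ij l
      \<comment> \<open>In the last column \<open>0 ^ (l - 1 - i)\<close> is 1 exactly for
        \<open>i = l - 1\<close>, by \<open>0 ^ 0 = 1\<close>.\<close>
      by (auto simp: lower_right_submat_def RS_mat_def vandermonde_rev_def x_def power_0_left)
  qed (auto simp: lower_right_submat_def vandermonde_rev_def)
qed

section \<open>Finiteness and the maximum\<close>

text \<open>\<open>Max\<close> in \<open>exponent_max\<close> is meaningful only over a finite set.
  A matrix is determined by its entries, a function between finite sets.\<close>

lemma finite_carrier_mat: "finite (carrier_mat m n :: 'a::finite mat set)"
proof (rule finite_subset)
  show "carrier_mat m n \<subseteq> mat m n ` (({..<m} \<times> {..<n}) \<rightarrow>\<^sub>E (UNIV :: 'a set))"
  proof
    fix A :: "'a mat" assume "A \<in> carrier_mat m n"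
    then have "A = mat m n (restrict (($$) A) ({..<m} \<times> {..<n}))"
      by (intro eq_matI) auto
    then show "A \<in> mat m n ` (({..<m} \<times> {..<n}) \<rightarrow>\<^sub>E UNIV)"
      by (rule image_eqI[where f = "mat m n"]) simp
  qed
qed (simp add: finite_PiE)

theorem mainTheorem3:
  fixes l :: nat
  assumes "2 \<le> l" and "l \<le> CARD('a::{field,finite})"
  shows "(\<forall>\<alpha>::'a. primitive_element \<alpha> \<longrightarrow>
            is_arg_max exponent_c (\<lambda>G. G \<in> invertible_mats l)
              (lower_right_submat l (RS_mat \<alpha>)))
         \<and> exponent_max TYPE('a) l = ln (fact l) / (real l * ln (real l))"
proof (intro conjI allI impI)
  fix \<alpha> :: 'a
  assume "primitive_element \<alpha>"
  then obtain x where "inj_on x {..<l}" "lower_right_submat l (RS_mat \<alpha>) = vandermonde_rev l x"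
    using lower_right_RS_mat_eq_vandermonde_rev assms by (metis not_numeral_le_zero not_gr_zero)
  then show "is_arg_max exponent_c (\<lambda>G. G \<in> invertible_mats l)
              (lower_right_submat l (RS_mat \<alpha>))"
    by (auto simp: is_arg_max_def vandermonde_rev_invertible exponent_c_vandermonde_rev
        not_less exponent_c_le)
next
  \<comment> \<open>This conjunct supplies no primitive element, so the maximum is attained here by
    a Vandermonde matrix at any \<open>l\<close> distinct field elements.\<close>
  obtain x :: "nat \<Rightarrow> 'a" where x: "inj_on x {..<l}"
    using card_le_inj[of "{..<l}" "UNIV :: 'a set"] assms(2) by auto
  have "finite (invertible_mats l :: 'a mat set)"
    by (rule finite_subset[OF _ finite_carrier_mat]) (auto simp: invertible_mats_def)
  then show "exponent_max TYPE('a) l = ln (fact l) / (real l * ln (real l))"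
    unfolding exponent_max_def
    using exponent_c_le vandermonde_rev_invertible[OF x] exponent_c_vandermonde_rev[OF x]
    by (intro Max_eqI) (auto intro: rev_image_eqI)
qed

end
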